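(* The set $I^{\forall^\infty}_{TD} = \{e : (\forall^\infty L \in \mathcal L_e)[\mathrm{TD}(L,\mathcal L_e) < \infty]\}$ is $\Sigma^0_5$-complete.
   Context: $W_0,W_1,\ldots$ is an acceptable numbering of all r.e. subsets of $\mathbb N$; $L^e_j = \{x : \langle j,x\rangle \in W_e\}$ and $\mathcal L_e = \{L^e_j : j\in\mathbb N\}$. $\forall^\infty$ means "for all but finitely many". For a family $\mathcal L$ of subsets of $\mathbb N$ and $L\in\mathcal L$: a set $T\subseteq \mathbb N\times\{+,-\}$, with $T^+=\{n:(n,+)\in T\}$, $T^-=\{n:(n,-)\in T\}$, is consistent with $L'$ iff $T^+\subseteq L'$ and $T^-\cap L'=\emptyset$; $T$ is a teaching set for $L$ w.r.t. $\mathcal L$ iff $T$ is consistent with $L$ and with no $L'\in\mathcal L\setminus\{L\}$. $\mathrm{TD}(L,\mathcal L)$ is the size of a smallest teaching set for $L$ w.r.t. $\mathcal L$ ($\infty$ if none is finite). $\Sigma^0_n$-complete means definable by a $\Sigma^0_n$ formula and every $\Sigma^0_n$ set many-one reduces to it via a recursive function. *)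

theory Defs
  imports Main "HOL-Library.Nat_Bijection" "HOL-Library.Extended_Nat"
begin

section \<open>Recursive functions and recursively enumerable sets\<close>

text \<open>
  \<open>recursive_fn n f\<close>: \<open>f\<close>, restricted to argument lists of length \<open>n\<close>, is a total recursive
  function of arity \<open>n\<close>. Minimisation is restricted to regular functions, so the
  class consists of total functions only. Rule \<open>ext\<close> makes the values of \<open>f\<close> on lists of any
  other length irrelevant. In \<open>prim_rec\<close> the recursion argument comes first and \<open>g\<close> receives
  the predecessor, the previous value and the parameters, in this order.
\<close>

inductive recursive_fn :: "nat \<Rightarrow> (nat list \<Rightarrow> nat) \<Rightarrow> bool" where
  zero: "recursive_fn n (\<lambda>xs. 0)"
| succ: "recursive_fn 1 (\<lambda>xs. Suc (hd xs))"
| proj: "i < n \<Longrightarrow> recursive_fn n (\<lambda>xs. xs ! i)"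
| comp: "recursive_fn (length gs) f \<Longrightarrow> (\<forall>g\<in>set gs. recursive_fn n g) \<Longrightarrow>
    recursive_fn n (\<lambda>xs. f (map (\<lambda>g. g xs) gs))"
| prim_rec: "recursive_fn n f \<Longrightarrow> recursive_fn (Suc (Suc n)) g \<Longrightarrow>
    recursive_fn (Suc n) (\<lambda>xs. rec_nat (f (tl xs)) (\<lambda>k r. g (k # r # tl xs)) (hd xs))"
| minimise: "recursive_fn (Suc n) f \<Longrightarrow> (\<forall>xs. length xs = n \<longrightarrow> (\<exists>y. f (y # xs) = 0)) \<Longrightarrow>
    recursive_fn n (\<lambda>xs. LEAST y. f (y # xs) = 0)"
| ext: "recursive_fn n f \<Longrightarrow> (\<forall>xs. length xs = n \<longrightarrow> f xs = g xs) \<Longrightarrow> recursive_fn n g"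

definition recursive1 :: "(nat \<Rightarrow> nat) \<Rightarrow> bool" where
  "recursive1 f \<longleftrightarrow> recursive_fn 1 (\<lambda>xs. f (hd xs))"

definition recursive_rel :: "nat \<Rightarrow> (nat list \<Rightarrow> bool) \<Rightarrow> bool" where
  "recursive_rel n P \<longleftrightarrow> recursive_fn n (\<lambda>xs. if P xs then 1 else 0)"

definition re_set :: "nat set \<Rightarrow> bool" where
  "re_set A \<longleftrightarrow> A = {} \<or> (\<exists>f. recursive1 f \<and> A = range f)"

definition uniformly_re :: "(nat \<Rightarrow> nat set) \<Rightarrow> bool" where
  "uniformly_re V \<longleftrightarrow> re_set {prod_encode (i, x) | i x. x \<in> V i}"

text \<open>
  Taking \<open>V\<close> constant shows that such a numbering covers all r.e. sets. These are exactly
  the numberings \<open>e \<mapsto> dom \<phi>\<^sub>e\<close> arising from acceptable numberings \<open>\<phi>\<close> of the partial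
  recursive functions.
\<close>

definition acceptable_numbering :: "(nat \<Rightarrow> nat set) \<Rightarrow> bool" where
  "acceptable_numbering W \<longleftrightarrow>
     uniformly_re W \<and> (\<forall>V. uniformly_re V \<longrightarrow> (\<exists>f. recursive1 f \<and> (\<forall>i. V i = W (f i))))"

section \<open>The arithmetical hierarchy\<close>

text \<open>
  \<open>quant_prefix True n P xs\<close> is \<open>\<exists>y\<^sub>1. \<forall>y\<^sub>2. \<dots> P (xs @ [y\<^sub>1, \<dots>, y\<^sub>n])\<close> with \<open>n\<close> alternating
  quantifiers; \<open>quant_prefix False n P xs\<close> is the same starting with \<open>\<forall>\<close>.
\<close>

fun quant_prefix :: "bool \<Rightarrow> nat \<Rightarrow> (nat list \<Rightarrow> bool) \<Rightarrow> nat list \<Rightarrow> bool" where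
  "quant_prefix b 0 P xs = P xs"
| "quant_prefix True (Suc n) P xs = (\<exists>y. quant_prefix False n P (xs @ [y]))"
| "quant_prefix False (Suc n) P xs = (\<forall>y. quant_prefix True n P (xs @ [y]))"

definition Sigma0 :: "nat \<Rightarrow> nat set \<Rightarrow> bool" where
  "Sigma0 n A \<longleftrightarrow>
     (\<exists>P. recursive_rel (Suc n) P \<and> (\<forall>x. x \<in> A \<longleftrightarrow> quant_prefix True n P [x]))"

definition many_one_reducible :: "nat set \<Rightarrow> nat set \<Rightarrow> bool" where
  "many_one_reducible A B \<longleftrightarrow> (\<exists>f. recursive1 f \<and> (\<forall>x. x \<in> A \<longleftrightarrow> f x \<in> B))"

definition Sigma0_complete :: "nat \<Rightarrow> nat set \<Rightarrow> bool" where
  "Sigma0_complete n A \<longleftrightarrow> Sigma0 n A \<and> (\<forall>B. Sigma0 n B \<longrightarrow> many_one_reducible B A)"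

section \<open>Teaching sets and the teaching dimension\<close>

datatype label = Plus | Minus

definition pos_part :: "(nat \<times> label) set \<Rightarrow> nat set" where
  "pos_part T = {n. (n, Plus) \<in> T}"

definition neg_part :: "(nat \<times> label) set \<Rightarrow> nat set" where
  "neg_part T = {n. (n, Minus) \<in> T}"

definition consistent_with :: "(nat \<times> label) set \<Rightarrow> nat set \<Rightarrow> bool" where
  "consistent_with T L \<longleftrightarrow> pos_part T \<subseteq> L \<and> neg_part T \<inter> L = {}"

definition teaching_set :: "(nat \<times> label) set \<Rightarrow> nat set \<Rightarrow> nat set set \<Rightarrow> bool" where
  "teaching_set T L \<L> \<longleftrightarrow>
     consistent_with T L \<and> (\<forall>L'\<in>\<L> - {L}. \<not> consistent_with T L')"

text \<open>The infimum of the empty set in \<^typ>\<open>enat\<close> is \<open>\<infinity>\<close>.\<close>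

definition TD :: "nat set \<Rightarrow> nat set set \<Rightarrow> enat" where
  "TD L \<L> = (INF T\<in>{T. finite T \<and> teaching_set T L \<L>}. enat (card T))"

section \<open>The index set\<close>

definition lang :: "(nat \<Rightarrow> nat set) \<Rightarrow> nat \<Rightarrow> nat \<Rightarrow> nat set" where
  "lang W e j = {x. prod_encode (j, x) \<in> W e}"

definition lang_family :: "(nat \<Rightarrow> nat set) \<Rightarrow> nat \<Rightarrow> nat set set" where
  "lang_family W e = range (lang W e)"

text \<open>The exceptions are counted as sets \<open>L\<close>, not as indices \<open>j\<close>.\<close>

definition I_TD_almost_all :: "(nat \<Rightarrow> nat set) \<Rightarrow> nat set" where
  "I_TD_almost_all W =
     {e. finite {L \<in> lang_family W e. \<not> TD L (lang_family W e) < \<infinity>}}"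

end

theory Submission
  imports Defs
begin

text \<open>
  Membership in \<open>\<Sigma>\<^sub>5\<close>: equality of two languages and being a teaching set are \<open>\<Pi>\<^sub>2\<close>, so it suffices
  to say that there is an \<open>N\<close> such that every \<open>L\<^sub>k\<close> has a finite teaching set or equals some \<open>L\<^sub>i\<close>
  with \<open>i \<le> N\<close>.

  Hardness: write a \<open>\<Sigma>\<^sub>5\<close> statement as \<open>\<exists>a. \<forall>b. Q a b\<close> with \<open>Q\<close> in \<open>\<Sigma>\<^sub>3\<close>, monotone in \<open>a\<close>, antitone
  in \<open>b\<close> and with \<open>Q a 0\<close>. It holds iff \<open>Q a b \<and> \<not> Q a (b + 1)\<close> for only finitely many pairs
  \<open>s = (a, b)\<close>. For each \<open>s\<close> take two r.e. chains of initial segments of a column \<open>{s} \<times> \<nat>\<close>, one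
  for \<open>Q a b\<close> and one for \<open>Q a (b + 1)\<close>. The members of a chain for \<open>\<exists>c. \<forall>d. U c d\<close> are unbounded
  finite segments if the statement fails, and almost all equal to the whole column if it holds.
  The first chain hence decides whether the whole column is in the family, the second one whether
  it then lacks a finite teaching set. Finite segments \<open>[0, m]\<close> are always taught by \<open>+m\<close> and
  \<open>-(m + 1)\<close>.
\<close>

section \<open>Recursive functions of several arguments\<close>

lemma recursive_fn_hd: "recursive_fn (Suc n) hd"
proof (rule recursive_fn.ext)
  show "recursive_fn (Suc n) (\<lambda>xs. xs ! 0)" by (rule recursive_fn.proj) simp
  show "\<forall>xs. length xs = Suc n \<longrightarrow> xs ! 0 = hd xs" by (auto simp: length_Suc_conv)
qed

lemma recursive_fn_comp1:
  assumes "recursive_fn 1 (\<lambda>xs. F (hd xs))" "recursive_fn n f"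
  shows "recursive_fn n (\<lambda>xs. F (f xs))"
  using recursive_fn.comp[of "[f]" "\<lambda>xs. F (hd xs)" n] assms by simp

lemma recursive_fn_comp2:
  assumes "recursive_fn 2 (\<lambda>xs. F (xs ! 0) (xs ! 1))" "recursive_fn n f" "recursive_fn n g"
  shows "recursive_fn n (\<lambda>xs. F (f xs) (g xs))"
  using recursive_fn.comp[of "[f, g]" "\<lambda>xs. F (xs ! 0) (xs ! 1)" n] assms
  by (simp add: numeral_2_eq_2)

lemma recursive_fn_Suc: "recursive_fn n f \<Longrightarrow> recursive_fn n (\<lambda>xs. Suc (f xs))"
  by (rule recursive_fn_comp1[of Suc]) (rule recursive_fn.succ)

lemma recursive_fn_const: "recursive_fn n (\<lambda>xs. c)"
  by (induction c) (auto intro: recursive_fn.zero recursive_fn_Suc)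

lemma recursive_fn_rec_nat1:
  assumes "recursive_fn 2 (\<lambda>xs. g (xs ! 0) (xs ! 1))"
  shows "recursive_fn 1 (\<lambda>xs. rec_nat c g (hd xs))"
  using recursive_fn.prim_rec[OF recursive_fn_const[of 0 c], of "\<lambda>xs. g (xs ! 0) (xs ! 1)"] assms
  by (simp add: numeral_2_eq_2)

lemma recursive_fn_rec_nat2:
  assumes "recursive_fn 1 (\<lambda>xs. f (hd xs))"
    and "recursive_fn 3 (\<lambda>xs. g (xs ! 0) (xs ! 1) (xs ! 2))"
  shows "recursive_fn 2 (\<lambda>xs. rec_nat (f (xs ! 1)) (\<lambda>k r. g k r (xs ! 1)) (xs ! 0))"
proof (rule recursive_fn.ext)
  show "recursive_fn 2 (\<lambda>xs. rec_nat (f (hd (tl xs)))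
      (\<lambda>k r. g ((k # r # tl xs) ! 0) ((k # r # tl xs) ! 1) ((k # r # tl xs) ! 2)) (hd xs))"
    using recursive_fn.prim_rec[of 1 "\<lambda>xs. f (hd xs)" "\<lambda>xs. g (xs ! 0) (xs ! 1) (xs ! 2)"] assms
    by (simp add: numeral_2_eq_2 numeral_3_eq_3)
qed (auto simp: numeral_2_eq_2 length_Suc_conv)

lemma recursive_fn_add:
  assumes "recursive_fn n f" "recursive_fn n g"
  shows "recursive_fn n (\<lambda>xs. f xs + g xs)"
proof -
  have "recursive_fn 2 (\<lambda>xs. rec_nat (xs ! 1) (\<lambda>k r. Suc r) (xs ! 0))"
    by (rule recursive_fn_rec_nat2[where f = "\<lambda>x. x"])
      (auto intro!: recursive_fn_hd[of 0, simplified] recursive_fn_Suc recursive_fn.proj)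
  moreover have "rec_nat y (\<lambda>k r. Suc r) x = x + y" for x y :: nat
    by (induction x) auto
  ultimately have "recursive_fn 2 (\<lambda>xs. xs ! 0 + xs ! 1)" by simp
  from recursive_fn_comp2[OF this assms] show ?thesis .
qed

lemma recursive_fn_pred:
  assumes "recursive_fn n f"
  shows "recursive_fn n (\<lambda>xs. f xs - 1)"
proof -
  have "recursive_fn 1 (\<lambda>xs. rec_nat 0 (\<lambda>k r. k) (hd xs))"
    by (rule recursive_fn_rec_nat1) (auto intro!: recursive_fn.proj)
  moreover have "rec_nat 0 (\<lambda>k r. k) x = x - 1" for x :: nat
    by (cases x) auto
  ultimately have "recursive_fn 1 (\<lambda>xs. hd xs - 1)" by simp
  from recursive_fn_comp1[OF this assms] show ?thesis .
qed

lemma recursive_fn_diff: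
  assumes "recursive_fn n f" "recursive_fn n g"
  shows "recursive_fn n (\<lambda>xs. f xs - g xs)"
proof -
  \<comment> \<open>The predecessor is iterated, so the recursion runs on the subtrahend, which is
    the first argument here.\<close>
  have "recursive_fn 2 (\<lambda>xs. rec_nat (xs ! 1) (\<lambda>k r. r - 1) (xs ! 0))"
    by (rule recursive_fn_rec_nat2[where f = "\<lambda>x. x"])
      (auto intro!: recursive_fn_hd[of 0, simplified] recursive_fn_pred[simplified] recursive_fn.proj)
  moreover have "rec_nat y (\<lambda>k r. r - 1) x = y - x" for x y :: nat
    by (induction x) auto
  ultimately have "recursive_fn 2 (\<lambda>xs. xs ! 1 - xs ! 0)" by simp
  from recursive_fn_comp2[OF this assms(2,1)] show ?thesis .
qed

lemma recursive_fn_triangle: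
  assumes "recursive_fn n f"
  shows "recursive_fn n (\<lambda>xs. triangle (f xs))"
proof -
  have "recursive_fn 1 (\<lambda>xs. rec_nat 0 (\<lambda>k r. r + Suc k) (hd xs))"
    by (rule recursive_fn_rec_nat1)
      (intro recursive_fn_add recursive_fn_Suc recursive_fn.proj; simp)
  moreover have "rec_nat 0 (\<lambda>k r. r + Suc k) x = triangle x" for x
    by (induction x) auto
  ultimately have "recursive_fn 1 (\<lambda>xs. triangle (hd xs))" by simp
  from recursive_fn_comp1[OF this assms] show ?thesis .
qed

lemma recursive_fn_prod_encode:
  assumes "recursive_fn n f" "recursive_fn n g"
  shows "recursive_fn n (\<lambda>xs. prod_encode (f xs, g xs))"
  unfolding prod_encode_def by (auto intro!: recursive_fn_add recursive_fn_triangle assms)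

section \<open>Recursive functions of one argument\<close>

abbreviation p1 :: "nat \<Rightarrow> nat" where "p1 z \<equiv> fst (prod_decode z)"
abbreviation p2 :: "nat \<Rightarrow> nat" where "p2 z \<equiv> snd (prod_decode z)"

text \<open>The pair \<open>(m, n)\<close> lies on the diagonal \<open>m + n\<close>, which is found by search.\<close>

lemma Least_triangle: "(LEAST t. Suc z - triangle (Suc t) = 0) = p1 z + p2 z"
proof -
  obtain m n where mn: "prod_decode z = (m, n)" by fastforce
  then have "z = prod_encode (m, n)" by (metis prod_decode_inverse)
  then have z: "z = triangle (m + n) + m" by (simp add: prod_encode_def)
  \<comment> \<open>Truncated subtraction makes the test say \<open>z < triangle (Suc t)\<close>:
    the first diagonal that ends beyond \<open>z\<close> is sought.\<close>
  have "(LEAST t. Suc z - triangle (Suc t) = 0) = m + n"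
  proof (rule Least_equality)
    show "Suc z - triangle (Suc (m + n)) = 0" by (simp add: z)
    fix t assume t: "Suc z - triangle (Suc t) = 0"
    show "m + n \<le> t"
    proof (rule ccontr)
      assume "\<not> m + n \<le> t"
      then have "triangle (Suc t) \<le> triangle (m + n)"
        unfolding triangle_def by (intro div_le_mono mult_le_mono) auto
      with t show False by (simp add: z)
    qed
  qed
  then show ?thesis by (simp add: mn)
qed

text \<open>\<open>triangle\<close> maps a diagonal to the code of its first pair, and
  \<open>p1 z\<close> is the offset of \<open>z\<close> from there.\<close>

lemma p1_eq: "z - triangle (p1 z + p2 z) = p1 z"
proof -
  obtain m n where mn: "prod_decode z = (m, n)" by fastforce
  then have "z = prod_encode (m, n)" by (metis prod_decode_inverse)
  then have "z = triangle (m + n) + m" by (simp add: prod_encode_def)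
  then show ?thesis unfolding mn by simp
qed

lemma recursive1_comp_fn:
  "recursive1 f \<Longrightarrow> recursive_fn n g \<Longrightarrow> recursive_fn n (\<lambda>xs. f (g xs))"
  unfolding recursive1_def by (rule recursive_fn_comp1)

lemma recursive1_comp: "recursive1 f \<Longrightarrow> recursive1 g \<Longrightarrow> recursive1 (\<lambda>z. f (g z))"
  unfolding recursive1_def by (rule recursive_fn_comp1)

lemma recursive1_comp_list:
  assumes "recursive_fn (length fs) F" "\<forall>f\<in>set fs. recursive1 f"
  shows "recursive1 (\<lambda>z. F (map (\<lambda>f. f z) fs))"
  using recursive_fn.comp[of "map (\<lambda>f xs. f (hd xs)) fs" F 1] assms
  by (simp add: recursive1_def comp_def)

lemma recursive1_id: "recursive1 (\<lambda>z. z)"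
  unfolding recursive1_def using recursive_fn_hd[of 0] by simp

lemma recursive1_const: "recursive1 (\<lambda>z. c)"
  unfolding recursive1_def by (rule recursive_fn_const)

lemma recursive1_p12: "recursive1 (\<lambda>z. p1 z + p2 z)"
proof -
  let ?F = "\<lambda>xs. Suc (xs ! 1) - triangle (Suc (xs ! 0))"
  have "recursive_fn 1 (\<lambda>xs. LEAST y. ?F (y # xs) = 0)"
  proof (rule recursive_fn.minimise)
    show "recursive_fn (Suc 1) ?F"
      by (intro recursive_fn_diff recursive_fn_triangle recursive_fn_Suc recursive_fn.proj; simp)
    \<comment> \<open>Regularity of the search: the argument itself always passes the test.\<close>
    have "x < triangle (Suc x)" for x by simp
    then show "\<forall>xs. length xs = 1 \<longrightarrow> (\<exists>y. ?F (y # xs) = 0)"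
      by (metis Suc_leI diff_is_0_eq nth_Cons_0 nth_Cons_Suc One_nat_def)
  qed
  then have "recursive_fn 1 (\<lambda>xs. p1 (xs ! 0) + p2 (xs ! 0))"
    using Least_triangle by simp
  then show ?thesis
    unfolding recursive1_def by (rule recursive_fn.ext) (auto simp: length_Suc_conv)
qed

lemma recursive1_p1_id: "recursive1 p1"
proof -
  have "recursive1 (\<lambda>z. z - triangle (p1 z + p2 z))"
    using recursive1_p12 recursive1_id unfolding recursive1_def
    by (intro recursive_fn_diff recursive_fn_triangle)
  then show ?thesis by (simp add: p1_eq)
qed

lemma recursive1_p2_id: "recursive1 p2"
proof -
  have "recursive1 (\<lambda>z. (p1 z + p2 z) - p1 z)"
    using recursive1_p12 recursive1_p1_id unfolding recursive1_def
    by (rule recursive_fn_diff)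
  then show ?thesis by simp
qed

lemmas recursive1_p1 = recursive1_comp[OF recursive1_p1_id]
lemmas recursive1_p2 = recursive1_comp[OF recursive1_p2_id]

lemma recursive1_Suc: "recursive1 f \<Longrightarrow> recursive1 (\<lambda>z. Suc (f z))"
  unfolding recursive1_def by (rule recursive_fn_Suc)

lemma recursive1_prod_encode:
  "recursive1 f \<Longrightarrow> recursive1 g \<Longrightarrow> recursive1 (\<lambda>z. prod_encode (f z, g z))"
  unfolding recursive1_def by (rule recursive_fn_prod_encode)

lemma recursive1_funpow:
  assumes "recursive1 g" "recursive1 h" "recursive1 f"
  shows "recursive1 (\<lambda>z. (g ^^ h z) (f z))"
proof -
  have "recursive_fn 2 (\<lambda>xs. rec_nat (xs ! 1) (\<lambda>k r. g r) (xs ! 0))"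
    by (rule recursive_fn_rec_nat2[where f = "\<lambda>x. x"])
      (auto intro!: recursive_fn_hd[of 0, simplified] recursive1_comp_fn[OF assms(1)] recursive_fn.proj)
  moreover have "rec_nat y (\<lambda>k. g) x = (g ^^ x) y" for x y :: nat
    by (induction x) auto
  ultimately have "recursive_fn 2 (\<lambda>xs. (g ^^ (xs ! 0)) (xs ! 1))" by simp
  from recursive_fn_comp2[OF this] show ?thesis
    using assms(2,3) unfolding recursive1_def by blast
qed

section \<open>Decidable predicates\<close>

text \<open>Several arguments are packed into one number by \<open>prod_encode\<close> and read off
  with \<open>p1\<close> and \<open>p2\<close>, so that closure rules for unary predicates
  suffice.\<close>

definition decidable :: "(nat \<Rightarrow> bool) \<Rightarrow> bool" where
  "decidable P \<longleftrightarrow> recursive1 (\<lambda>z. if P z then 1 else 0)"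

lemma decidable_comp: "decidable P \<Longrightarrow> recursive1 f \<Longrightarrow> decidable (\<lambda>z. P (f z))"
  unfolding decidable_def by (rule recursive1_comp)

lemma decidable_comp2:
  assumes "decidable (\<lambda>w. R (p1 w) (p2 w))" "recursive1 f" "recursive1 g"
  shows "decidable (\<lambda>z. R (f z) (g z))"
  using decidable_comp[OF assms(1) recursive1_prod_encode[OF assms(2,3)]] by simp

lemma decidable_not: "decidable P \<Longrightarrow> decidable (\<lambda>z. \<not> P z)"
  unfolding decidable_def recursive1_def
  using recursive_fn_diff[OF recursive_fn_const[of 1 1], of "\<lambda>xs. if P (hd xs) then 1 else 0"]
  by (simp add: if_distrib[of "\<lambda>x. Suc 0 - x"] if_distribR cong: if_cong)
    (smt (verit) recursive_fn.ext)

lemma decidable_le: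
  assumes "recursive1 f" "recursive1 g"
  shows "decidable (\<lambda>z. f z \<le> g z)"
proof -
  have "recursive_fn 1 (\<lambda>xs. 1 - (f (hd xs) - g (hd xs)))"
    using assms unfolding recursive1_def by (intro recursive_fn_diff recursive_fn_const)
  then show ?thesis
    unfolding decidable_def recursive1_def by (rule recursive_fn.ext) auto
qed

lemma decidable_less:
  "recursive1 f \<Longrightarrow> recursive1 g \<Longrightarrow> decidable (\<lambda>z. f z < g z)"
  using decidable_le[of "\<lambda>z. Suc (f z)" g] by (simp add: recursive1_Suc Suc_le_eq)

lemma decidable_disj:
  assumes "decidable P" "decidable Q"
  shows "decidable (\<lambda>z. P z \<or> Q z)"
proof -
  have "recursive1 (\<lambda>z. (if P z then 1 else 0) + (if Q z then 1 else 0))"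
    using assms unfolding decidable_def recursive1_def by (rule recursive_fn_add)
  then have "decidable (\<lambda>z. 0 < (if P z then 1 else 0 :: nat) + (if Q z then 1 else 0))"
    by (intro decidable_less recursive1_const)
  then show ?thesis by (rule back_subst[of decidable]) auto
qed

lemma decidable_conj: "decidable P \<Longrightarrow> decidable Q \<Longrightarrow> decidable (\<lambda>z. P z \<and> Q z)"
  using decidable_not[OF decidable_disj[OF decidable_not decidable_not, of P Q]] by simp

lemma decidable_eq:
  "recursive1 f \<Longrightarrow> recursive1 g \<Longrightarrow> decidable (\<lambda>z. f z = g z)"
  using decidable_conj[OF decidable_le[of f g] decidable_le[of g f]]
  by (simp add: order_eq_iff)

lemma recursive1_Least:
  assumes "decidable (\<lambda>w. P (p1 w) (p2 w))" "\<And>z. \<exists>y. P z y"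
  shows "recursive1 (\<lambda>z. LEAST y. P z y)"
proof -
  \<comment> \<open>\<open>?c\<close> is 0 exactly where \<open>P\<close> holds, since
    \<open>minimise\<close> looks for zeros. Its search variable comes first in the list, hence the
    swap in \<open>?F\<close>.\<close>
  let ?c = "\<lambda>z. if \<not> P (p1 z) (p2 z) then 1 else 0 :: nat"
  let ?F = "\<lambda>xs. ?c (prod_encode (xs ! 1, xs ! 0))"
  have "recursive_fn 1 (\<lambda>xs. LEAST y. ?F (y # xs) = 0)"
  proof (rule recursive_fn.minimise)
    have "recursive1 ?c" using decidable_not[OF assms(1)] by (simp only: decidable_def)
    then show "recursive_fn (Suc 1) ?F"
      by (rule recursive1_comp_fn) (intro recursive_fn_prod_encode recursive_fn.proj; simp)
  qed (use assms(2) in simp)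
  then show ?thesis
    unfolding recursive1_def by (rule recursive_fn.ext) (auto simp: length_Suc_conv)
qed

lemma decidable_bex:
  assumes "decidable (\<lambda>w. P (p1 w) (p2 w))" "recursive1 f"
  shows "decidable (\<lambda>z. \<exists>y<f z. P z y)"
proof -
  \<comment> \<open>The disjunct \<open>f z \<le> y\<close> makes the search total; it stops below
    \<open>f z\<close> iff a witness lies there.\<close>
  let ?l = "\<lambda>z. LEAST y. f z \<le> y \<or> P z y"
  have "recursive1 ?l"
    by (rule recursive1_Least)
      (auto intro!: decidable_disj decidable_le assms recursive1_comp[OF assms(2)]
        recursive1_p1_id recursive1_p2_id)
  then have "decidable (\<lambda>z. ?l z < f z)" by (intro decidable_less assms)
  moreover have "?l z < f z \<longleftrightarrow> (\<exists>y<f z. P z y)" for z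
  proof
    have "f z \<le> ?l z \<or> P z (?l z)"
      by (rule LeastI[of "\<lambda>y. f z \<le> y \<or> P z y" "f z"]) simp
    then show "?l z < f z \<Longrightarrow> \<exists>y<f z. P z y" by auto
  next
    assume "\<exists>y<f z. P z y"
    then obtain y where "y < f z" "P z y" by blast
    moreover from this have "?l z \<le> y" by (intro Least_le) simp
    ultimately show "?l z < f z" by simp
  qed
  ultimately show ?thesis by simp
qed

lemma decidable_ball:
  assumes "decidable (\<lambda>w. P (p1 w) (p2 w))" "recursive1 f"
  shows "decidable (\<lambda>z. \<forall>y<f z. P z y)"
  using decidable_not[OF decidable_bex[OF decidable_not[OF assms(1)] assms(2)]] by simp

lemma recursive1_if:
  assumes "decidable P" "recursive1 f" "recursive1 g"
  shows "recursive1 (\<lambda>z. if P z then f z else g z)"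
proof -
  \<comment> \<open>The value is the only solution of a decidable condition, so it can be found by
    search.\<close>
  have "recursive1 (\<lambda>z. LEAST y. P z \<and> y = f z \<or> \<not> P z \<and> y = g z)"
    by (rule recursive1_Least)
      (auto intro!: decidable_disj decidable_conj decidable_not decidable_eq
        decidable_comp[OF assms(1)] recursive1_comp[OF assms(2)] recursive1_comp[OF assms(3)]
        recursive1_p1_id recursive1_p2_id)
  moreover have "(LEAST y. P z \<and> y = f z \<or> \<not> P z \<and> y = g z) = (if P z then f z else g z)" for z
    by (auto intro!: Least_equality)
  ultimately show ?thesis by simp
qed

section \<open>Semidecidable and \<open>\<Pi>\<^sub>2\<close> predicates\<close>

definition semidecidable :: "(nat \<Rightarrow> bool) \<Rightarrow> bool" where
  "semidecidable P \<longleftrightarrow> (\<exists>R. decidable (\<lambda>w. R (p1 w) (p2 w)) \<and> P = (\<lambda>z. \<exists>y. R z y))"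

lemma semidecidableI: "decidable (\<lambda>w. R (p1 w) (p2 w)) \<Longrightarrow> semidecidable (\<lambda>z. \<exists>y. R z y)"
  unfolding semidecidable_def by blast

text \<open>Delivers the matrix \<open>R\<close> already closed under substitution of recursive
  functions, the form in which it serves as an introduction rule.\<close>

lemma semidecidableE:
  assumes "semidecidable P"
  obtains R where "\<And>f g. recursive1 f \<Longrightarrow> recursive1 g \<Longrightarrow> decidable (\<lambda>z. R (f z) (g z))"
    "P = (\<lambda>z. \<exists>y. R z y)"
  using assms decidable_comp2 unfolding semidecidable_def by metis

lemmas recursive1_intros = recursive1_p1 recursive1_p2 recursive1_id recursive1_const
  recursive1_Suc recursive1_prod_encode

lemma semidecidable_comp:
  assumes "semidecidable P" "recursive1 f" shows "semidecidable (\<lambda>z. P (f z))"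
proof -
  from assms(1) obtain R
    where R: "\<And>f g. recursive1 f \<Longrightarrow> recursive1 g \<Longrightarrow> decidable (\<lambda>z. R (f z) (g z))"
      and P: "P = (\<lambda>z. \<exists>y. R z y)" by (rule semidecidableE) blast
  show ?thesis unfolding P
    by (rule semidecidableI) (intro R recursive1_comp[OF assms(2)] recursive1_intros)
qed

lemma semidecidable_decidable: "decidable P \<Longrightarrow> semidecidable P"
  using semidecidableI[of "\<lambda>z y. P z"] decidable_comp[OF _ recursive1_p1_id] by simp

lemma semidecidable_ex:
  assumes "semidecidable (\<lambda>w. P (p1 w) (p2 w))" shows "semidecidable (\<lambda>z. \<exists>y. P z y)"
proof -
  from assms obtain R
    where R: "\<And>f g. recursive1 f \<Longrightarrow> recursive1 g \<Longrightarrow> decidable (\<lambda>z. R (f z) (g z))"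
      and P: "(\<lambda>w. P (p1 w) (p2 w)) = (\<lambda>z. \<exists>y. R z y)" by (rule semidecidableE) blast
  have "P z y \<longleftrightarrow> (\<exists>u. R (prod_encode (z, y)) u)" for z y
    using fun_cong[OF P, of "prod_encode (z, y)"] by simp
  \<comment> \<open>One number \<open>v\<close> codes both existential witnesses.\<close>
  then have "(\<exists>y. P z y) \<longleftrightarrow> (\<exists>v. R (prod_encode (z, p1 v)) (p2 v))" for z
    by (metis prod_encode_inverse fst_conv snd_conv)
  then show ?thesis
    by simp (intro semidecidableI R recursive1_intros)
qed

lemma semidecidable_conj:
  assumes "semidecidable P" "semidecidable Q" shows "semidecidable (\<lambda>z. P z \<and> Q z)"
proof -
  from assms(1) obtain R
    where R: "\<And>f g. recursive1 f \<Longrightarrow> recursive1 g \<Longrightarrow> decidable (\<lambda>z. R (f z) (g z))"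
      and P: "P = (\<lambda>z. \<exists>y. R z y)" by (rule semidecidableE) blast
  from assms(2) obtain S
    where S: "\<And>f g. recursive1 f \<Longrightarrow> recursive1 g \<Longrightarrow> decidable (\<lambda>z. S (f z) (g z))"
      and Q: "Q = (\<lambda>z. \<exists>y. S z y)" by (rule semidecidableE) blast
  have "semidecidable (\<lambda>z. \<exists>u v. R z u \<and> S z v)"
    by (intro semidecidable_ex semidecidable_decidable decidable_conj R S recursive1_intros)
  then show ?thesis by (simp add: P Q)
qed

lemma semidecidable_disj:
  assumes "semidecidable P" "semidecidable Q" shows "semidecidable (\<lambda>z. P z \<or> Q z)"
proof -
  from assms(1) obtain R
    where R: "\<And>f g. recursive1 f \<Longrightarrow> recursive1 g \<Longrightarrow> decidable (\<lambda>z. R (f z) (g z))"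
      and P: "P = (\<lambda>z. \<exists>y. R z y)" by (rule semidecidableE) blast
  from assms(2) obtain S
    where S: "\<And>f g. recursive1 f \<Longrightarrow> recursive1 g \<Longrightarrow> decidable (\<lambda>z. S (f z) (g z))"
      and Q: "Q = (\<lambda>z. \<exists>y. S z y)" by (rule semidecidableE) blast
  have "semidecidable (\<lambda>z. \<exists>u. R z u \<or> S z u)"
    by (intro semidecidable_ex semidecidable_decidable decidable_disj R S recursive1_intros)
  then show ?thesis by (simp add: P Q ex_disj_distrib)
qed

text \<open>Finitely many witnesses have a common bound \<open>t\<close>; with \<open>t\<close>
  quantified first, only bounded quantifiers remain behind it.\<close>

lemma semidecidable_ball:
  assumes "semidecidable (\<lambda>w. P (p1 w) (p2 w))" "recursive1 f"
  shows "semidecidable (\<lambda>z. \<forall>y<f z. P z y)"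
proof -
  from assms(1) obtain R
    where R: "\<And>f g. recursive1 f \<Longrightarrow> recursive1 g \<Longrightarrow> decidable (\<lambda>z. R (f z) (g z))"
      and P: "(\<lambda>w. P (p1 w) (p2 w)) = (\<lambda>z. \<exists>y. R z y)" by (rule semidecidableE) blast
  have P': "P z y \<longleftrightarrow> (\<exists>u. R (prod_encode (z, y)) u)" for z y
    using fun_cong[OF P, of "prod_encode (z, y)"] by simp
  have "(\<forall>y<f z. P z y) \<longleftrightarrow> (\<exists>t. \<forall>y<f z. \<exists>u<t. R (prod_encode (z, y)) u)" for z
  proof
    assume "\<forall>y<f z. P z y"
    then obtain u where u: "\<And>y. y < f z \<Longrightarrow> R (prod_encode (z, y)) (u y)"
      unfolding P' by metis
    have "u y < Suc (Max (u ` {..<f z}))" if "y < f z" for y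
      using that by (simp add: less_Suc_eq_le)
    with u show "\<exists>t. \<forall>y<f z. \<exists>u<t. R (prod_encode (z, y)) u" by blast
  qed (auto simp: P')
  then show ?thesis
    by simp (intro semidecidableI decidable_ball decidable_bex R recursive1_intros
        recursive1_comp[OF assms(2)])
qed

section \<open>Closure properties of \<open>\<Pi>\<^sub>2\<close> predicates\<close>

definition Pi2 :: "(nat \<Rightarrow> bool) \<Rightarrow> bool" where
  "Pi2 P \<longleftrightarrow> (\<exists>S. semidecidable (\<lambda>w. S (p1 w) (p2 w)) \<and> P = (\<lambda>z. \<forall>y. S z y))"

lemma Pi2I: "semidecidable (\<lambda>w. S (p1 w) (p2 w)) \<Longrightarrow> Pi2 (\<lambda>z. \<forall>y. S z y)"
  unfolding Pi2_def by blast

lemma Pi2E: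
  assumes "Pi2 P"
  obtains S where "\<And>f g. recursive1 f \<Longrightarrow> recursive1 g \<Longrightarrow> semidecidable (\<lambda>z. S (f z) (g z))"
    "P = (\<lambda>z. \<forall>y. S z y)"
proof -
  from assms obtain S where S: "semidecidable (\<lambda>w. S (p1 w) (p2 w))" "P = (\<lambda>z. \<forall>y. S z y)"
    unfolding Pi2_def by blast
  show thesis
    using that[of S] S(2) semidecidable_comp[OF S(1) recursive1_prod_encode] by simp
qed

lemma Pi2_semidecidable: "semidecidable P \<Longrightarrow> Pi2 P"
  using Pi2I[of "\<lambda>z y. P z"] semidecidable_comp[OF _ recursive1_p1_id] by simp

lemma Pi2_not_semidecidable:
  assumes "semidecidable P" shows "Pi2 (\<lambda>z. \<not> P z)"
proof -
  from assms obtain R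
    where R: "\<And>f g. recursive1 f \<Longrightarrow> recursive1 g \<Longrightarrow> decidable (\<lambda>z. R (f z) (g z))"
      and P: "P = (\<lambda>z. \<exists>y. R z y)" by (rule semidecidableE) blast
  show ?thesis unfolding P not_ex
    by (intro Pi2I semidecidable_decidable decidable_not R recursive1_intros)
qed

lemma Pi2_all:
  assumes "Pi2 (\<lambda>w. P (p1 w) (p2 w))" shows "Pi2 (\<lambda>z. \<forall>y. P z y)"
proof -
  from assms obtain S
    where S: "\<And>f g. recursive1 f \<Longrightarrow> recursive1 g \<Longrightarrow> semidecidable (\<lambda>z. S (f z) (g z))"
      and P: "(\<lambda>w. P (p1 w) (p2 w)) = (\<lambda>z. \<forall>y. S z y)" by (rule Pi2E) blast
  have "P z y \<longleftrightarrow> (\<forall>u. S (prod_encode (z, y)) u)" for z y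
    using fun_cong[OF P, of "prod_encode (z, y)"] by simp
  then have "(\<forall>y. P z y) \<longleftrightarrow> (\<forall>v. S (prod_encode (z, p1 v)) (p2 v))" for z
    by (metis prod_encode_inverse fst_conv snd_conv)
  then show ?thesis
    by simp (intro Pi2I S recursive1_intros)
qed

lemma Pi2_conj:
  assumes "Pi2 P" "Pi2 Q" shows "Pi2 (\<lambda>z. P z \<and> Q z)"
proof -
  from assms(1) obtain R
    where R: "\<And>f g. recursive1 f \<Longrightarrow> recursive1 g \<Longrightarrow> semidecidable (\<lambda>z. R (f z) (g z))"
      and P: "P = (\<lambda>z. \<forall>y. R z y)" by (rule Pi2E) blast
  from assms(2) obtain S
    where S: "\<And>f g. recursive1 f \<Longrightarrow> recursive1 g \<Longrightarrow> semidecidable (\<lambda>z. S (f z) (g z))"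
      and Q: "Q = (\<lambda>z. \<forall>y. S z y)" by (rule Pi2E) blast
  have "Pi2 (\<lambda>z. \<forall>u. R z u \<and> S z u)"
    by (intro Pi2I semidecidable_conj R S recursive1_intros)
  then show ?thesis by (simp add: P Q all_conj_distrib)
qed

text \<open>Universal quantifiers do not distribute over a disjunction, so both variables are kept
  and then merged by \<open>Pi2_all\<close>.\<close>

lemma Pi2_disj:
  assumes "Pi2 P" "Pi2 Q" shows "Pi2 (\<lambda>z. P z \<or> Q z)"
proof -
  from assms(1) obtain R
    where R: "\<And>f g. recursive1 f \<Longrightarrow> recursive1 g \<Longrightarrow> semidecidable (\<lambda>z. R (f z) (g z))"
      and P: "P = (\<lambda>z. \<forall>y. R z y)" by (rule Pi2E) blast
  from assms(2) obtain S
    where S: "\<And>f g. recursive1 f \<Longrightarrow> recursive1 g \<Longrightarrow> semidecidable (\<lambda>z. S (f z) (g z))"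
      and Q: "Q = (\<lambda>z. \<forall>y. S z y)" by (rule Pi2E) blast
  have "Pi2 (\<lambda>z. \<forall>u v. R z u \<or> S z v)"
    by (intro Pi2_all Pi2_semidecidable semidecidable_disj R S recursive1_intros)
  then show ?thesis by (simp add: P Q)
qed

section \<open>Recursively enumerable sets as semidecidable predicates\<close>

lemma re_set_semidecidable:
  assumes "re_set A" shows "semidecidable (\<lambda>z. z \<in> A)"
proof (cases "A = {}")
  case True
  then show ?thesis
    using semidecidable_decidable[OF decidable_less[OF recursive1_const recursive1_const, of 0 0]]
    by simp
next
  case False
  then obtain f where f: "recursive1 f" "A = range f" using assms unfolding re_set_def by blast
  have "semidecidable (\<lambda>z. \<exists>y. z = f y)"
    by (intro semidecidableI decidable_eq recursive1_comp[OF f(1)] recursive1_intros)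
  then show ?thesis by (simp add: f(2) image_iff)
qed

lemma semidecidable_re_set:
  assumes "semidecidable P" shows "re_set {z. P z}"
proof (cases "{z. P z} = {}")
  case False
  then obtain a where a: "P a" by blast
  from assms obtain R
    where R: "\<And>f g. recursive1 f \<Longrightarrow> recursive1 g \<Longrightarrow> decidable (\<lambda>z. R (f z) (g z))"
      and P: "P = (\<lambda>z. \<exists>y. R z y)" by (rule semidecidableE) blast
  \<comment> \<open>The known element \<open>a\<close> is the default value on pairs whose second
    component is not a witness.\<close>
  let ?f = "\<lambda>w. if R (p1 w) (p2 w) then p1 w else a"
  have "recursive1 ?f" by (intro recursive1_if R recursive1_intros)
  moreover have "{z. P z} = range ?f"
  proof (intro equalityI subsetI)
    fix z assume "z \<in> {z. P z}"
    then obtain y where "R z y" by (auto simp: P)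
    then show "z \<in> range ?f" by (intro image_eqI[of _ _ "prod_encode (z, y)"]) auto
  qed (use a in \<open>auto simp: P\<close>)
  ultimately show ?thesis unfolding re_set_def by blast
qed (simp add: re_set_def)

section \<open>Codes for finite sequences and finite sets\<close>

text \<open>Every number codes an infinite sequence with head \<open>p1\<close> and tail
  \<open>p2\<close>. No length is stored, so decoding is total.\<close>

definition seq_nth :: "nat \<Rightarrow> nat \<Rightarrow> nat" where
  "seq_nth s i = p1 ((p2 ^^ i) s)"

lemma recursive1_seq_nth:
  "recursive1 f \<Longrightarrow> recursive1 g \<Longrightarrow> recursive1 (\<lambda>z. seq_nth (f z) (g z))"
  unfolding seq_nth_def by (intro recursive1_p1 recursive1_funpow recursive1_p2_id)

lemma seq_nth_0: "seq_nth (prod_encode (a, s)) 0 = a"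
  by (simp add: seq_nth_def)

lemma seq_nth_Suc: "seq_nth (prod_encode (a, s)) (Suc i) = seq_nth s i"
  by (simp add: seq_nth_def funpow_Suc_right del: funpow.simps)

text \<open>Induction prepends \<open>h 0\<close> to a code for the shifted \<open>h\<close>; the
  entries from \<open>n\<close> on are left open.\<close>

lemma ex_seq_nth: "\<exists>s. \<forall>i<n. seq_nth s i = h i"
proof (induction n arbitrary: h)
  case (Suc n)
  from Suc[of "\<lambda>i. h (Suc i)"] obtain s where "\<forall>i<n. seq_nth s i = h (Suc i)" by blast
  then have "\<forall>i<Suc n. seq_nth (prod_encode (h 0, s)) i = h i"
    by (simp add: All_less_Suc2 seq_nth_0 seq_nth_Suc)
  then show ?case by blast
qed simp

text \<open>A bound paired with a characteristic sequence. The bound makes every code denote a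
  finite set and turns inclusion into a bounded quantification.\<close>

definition set_of_code :: "nat \<Rightarrow> nat set" where
  "set_of_code p = {n. n < p1 p \<and> seq_nth (p2 p) n = 1}"

lemma finite_set_of_code: "finite (set_of_code p)"
  by (rule finite_subset[of _ "{..<p1 p}"]) (auto simp: set_of_code_def)

lemma ex_set_of_code:
  assumes "finite D" shows "\<exists>p. set_of_code p = D"
proof -
  obtain m where m: "\<forall>n\<in>D. n < m"
    using finite_nat_set_iff_bounded[THEN iffD1, OF assms] by blast
  obtain s where s: "\<forall>i<m. seq_nth s i = (if i \<in> D then 1 else 0)"
    using ex_seq_nth[of m "\<lambda>i. if i \<in> D then 1 else 0"] by blast
  have "n \<in> set_of_code (prod_encode (m, s)) \<longleftrightarrow> n < m \<and> n \<in> D" for n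
    using s by (cases "n < m") (simp_all add: set_of_code_def)
  with m have "set_of_code (prod_encode (m, s)) = D" by blast
  then show ?thesis by blast
qed

lemma decidable_set_of_code:
  "recursive1 f \<Longrightarrow> recursive1 g \<Longrightarrow> decidable (\<lambda>z. f z \<in> set_of_code (g z))"
  unfolding set_of_code_def mem_Collect_eq
  by (intro decidable_conj decidable_less decidable_eq recursive1_seq_nth recursive1_intros)

section \<open>The fifth level of the arithmetical hierarchy\<close>

lemma quant_prefix_5:
  "quant_prefix True 5 P [x] \<longleftrightarrow> (\<exists>a. \<forall>b. \<exists>c. \<forall>d. \<exists>e. P [x, a, b, c, d, e])"
  by (simp add: eval_nat_numeral)

text \<open>The \<open>\<Pi>\<^sub>2\<close> matrix absorbs the last two of the five alternating
  quantifiers.\<close>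

lemma Sigma0_5I:
  assumes "Pi2 (\<lambda>w. M (p1 w) (p1 (p2 w)) (p1 (p2 (p2 w))) (p2 (p2 (p2 w))))"
  shows "Sigma0 5 {x. \<exists>a. \<forall>b. \<exists>c. M x a b c}"
proof -
  from assms obtain S
    where S: "\<And>f g. recursive1 f \<Longrightarrow> recursive1 g \<Longrightarrow> semidecidable (\<lambda>z. S (f z) (g z))"
      and M: "(\<lambda>w. M (p1 w) (p1 (p2 w)) (p1 (p2 (p2 w))) (p2 (p2 (p2 w)))) = (\<lambda>z. \<forall>y. S z y)"
    by (rule Pi2E) blast
  have "semidecidable (\<lambda>w. S (p1 w) (p2 w))" by (intro S recursive1_intros)
  then obtain R
    where R: "\<And>f g. recursive1 f \<Longrightarrow> recursive1 g \<Longrightarrow> decidable (\<lambda>z. R (f z) (g z))"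
      and S': "(\<lambda>w. S (p1 w) (p2 w)) = (\<lambda>z. \<exists>y. R z y)" by (rule semidecidableE) blast
  define code where
    "code a b c d = prod_encode (a, prod_encode (b, prod_encode (c, d)))" for a b c d
  have M': "M x a b c \<longleftrightarrow> (\<forall>d. \<exists>e. R (prod_encode (code x a b c, d)) e)" for x a b c
    using fun_cong[OF M, of "code x a b c"] fun_cong[OF S', of "prod_encode (code x a b c, d)" for d]
    by (simp add: code_def)
  define P where "P xs = R (prod_encode (code (xs ! 0) (xs ! 1) (xs ! 2) (xs ! 3), xs ! 4)) (xs ! 5)"
    for xs
  have "recursive1 (\<lambda>w. if R (p1 w) (p2 w) then 1 else 0)"
    using R[OF recursive1_p1_id recursive1_p2_id] unfolding decidable_def .
  then have "recursive_fn 6 (\<lambda>xs. (\<lambda>w. if R (p1 w) (p2 w) then 1 else 0)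
      (prod_encode (prod_encode (code (xs ! 0) (xs ! 1) (xs ! 2) (xs ! 3), xs ! 4), xs ! 5)))"
    unfolding code_def
    by (rule recursive1_comp_fn) (intro recursive_fn_prod_encode recursive_fn.proj; simp)
  then have "recursive_rel (Suc 5) P" by (simp add: recursive_rel_def P_def)
  moreover have "x \<in> {x. \<exists>a. \<forall>b. \<exists>c. M x a b c} \<longleftrightarrow> quant_prefix True 5 P [x]" for x
    unfolding quant_prefix_5 by (simp add: M' P_def)
  ultimately show ?thesis unfolding Sigma0_def by blast
qed

text \<open>Replaces the list predicate behind \<open>Sigma0\<close> by a relation of separate
  arguments, into which recursive functions can be substituted.\<close>

lemma Sigma0_5E:
  assumes "Sigma0 5 A"
  obtains R where "\<And>f0 f1 f2 f3 f4 f5. recursive1 f0 \<Longrightarrow> recursive1 f1 \<Longrightarrow> recursive1 f2 \<Longrightarrow>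
      recursive1 f3 \<Longrightarrow> recursive1 f4 \<Longrightarrow> recursive1 f5 \<Longrightarrow>
      decidable (\<lambda>z. R (f0 z) (f1 z) (f2 z) (f3 z) (f4 z) (f5 z))"
    "\<And>x. x \<in> A \<longleftrightarrow> (\<exists>a. \<forall>b. \<exists>c. \<forall>d. \<exists>e. R x a b c d e)"
proof -
  from assms obtain P where P: "recursive_rel 6 P" "\<And>x. x \<in> A \<longleftrightarrow> quant_prefix True 5 P [x]"
    unfolding Sigma0_def by auto
  show thesis
  proof (rule that[of "\<lambda>x a b c d e. P [x, a, b, c, d, e]"])
    fix f0 f1 f2 f3 f4 f5
    assume "recursive1 f0" "recursive1 f1" "recursive1 f2" "recursive1 f3" "recursive1 f4" "recursive1 f5"
    then show "decidable (\<lambda>z. P [f0 z, f1 z, f2 z, f3 z, f4 z, f5 z])"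
      using recursive1_comp_list[of "[f0, f1, f2, f3, f4, f5]"] P(1)
      by (simp add: decidable_def recursive_rel_def eval_nat_numeral)
  qed (simp add: P(2) quant_prefix_5)
qed

section \<open>Membership in \<open>\<Sigma>\<^sub>5\<close>\<close>

text \<open>A labelled set splits into its positive and its negative part; cardinalities disappear,
  as only finiteness matters.\<close>

lemma TD_less_infinity_iff:
  "TD L \<L> < \<infinity> \<longleftrightarrow> (\<exists>P N. finite P \<and> finite N \<and> P \<subseteq> L \<and> N \<inter> L = {} \<and>
     (\<forall>L'\<in>\<L>. P \<subseteq> L' \<and> N \<inter> L' = {} \<longrightarrow> L' = L))"
proof -
  have "TD L \<L> < \<infinity> \<longleftrightarrow> (\<exists>T. finite T \<and> teaching_set T L \<L>)"
    unfolding TD_def INF_less_iff by simp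
  also have "\<dots> \<longleftrightarrow> (\<exists>P N. finite P \<and> finite N \<and> P \<subseteq> L \<and> N \<inter> L = {} \<and>
     (\<forall>L'\<in>\<L>. P \<subseteq> L' \<and> N \<inter> L' = {} \<longrightarrow> L' = L))" (is "?l \<longleftrightarrow> ?r")
  proof
    assume ?l
    then obtain T where T: "finite T" "teaching_set T L \<L>" by blast
    have "pos_part T \<subseteq> fst ` T" "neg_part T \<subseteq> fst ` T"
      by (force simp: pos_part_def neg_part_def)+
    then have "finite (pos_part T)" "finite (neg_part T)"
      using T(1) by (auto intro: finite_subset)
    moreover have "pos_part T \<subseteq> L" "neg_part T \<inter> L = {}"
      "\<forall>L'\<in>\<L>. pos_part T \<subseteq> L' \<and> neg_part T \<inter> L' = {} \<longrightarrow> L' = L"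
      using T(2) unfolding teaching_set_def consistent_with_def by simp_all (metis DiffI singletonD)
    ultimately show ?r by metis
  next
    assume ?r
    then obtain P N where PN: "finite P" "finite N" "P \<subseteq> L" "N \<inter> L = {}"
      "\<forall>L'\<in>\<L>. P \<subseteq> L' \<and> N \<inter> L' = {} \<longrightarrow> L' = L" by blast
    let ?T = "P \<times> {Plus} \<union> N \<times> {Minus}"
    have "pos_part ?T = P" "neg_part ?T = N" by (auto simp: pos_part_def neg_part_def)
    then have "teaching_set ?T L \<L>"
      unfolding teaching_set_def consistent_with_def using PN(3-5) by (simp, blast)
    moreover have "finite ?T" using PN(1,2) by simp
    ultimately show ?l by metis
  qed
  finally show ?thesis .
qed

lemma TD_less_infinity_iff_codes:
  "TD L \<L> < \<infinity> \<longleftrightarrow> (\<exists>p q. set_of_code p \<subseteq> L \<and> set_of_code q \<inter> L = {} \<and>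
     (\<forall>L'\<in>\<L>. set_of_code p \<subseteq> L' \<and> set_of_code q \<inter> L' = {} \<longrightarrow> L' = L))"
proof -
  have "(\<exists>P N. finite P \<and> finite N \<and> Q P N) \<longleftrightarrow> (\<exists>p q. Q (set_of_code p) (set_of_code q))" for Q
    using finite_set_of_code ex_set_of_code by (intro iffI) (elim exE conjE, metis, blast)
  then show ?thesis unfolding TD_less_infinity_iff .
qed

section \<open>Complexity of consistency, of equality of languages and of the index set\<close>

context
  fixes W :: "nat \<Rightarrow> nat set"
  assumes W: "uniformly_re W"
begin

lemma semidecidable_lang:
  assumes "recursive1 f" "recursive1 g" "recursive1 h"
  shows "semidecidable (\<lambda>z. h z \<in> lang W (f z) (g z))"
proof -
  have "semidecidable (\<lambda>z. prod_encode (f z, prod_encode (g z, h z)) \<in> {prod_encode (i, x) |i x. x \<in> W i})"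
    using W unfolding uniformly_re_def
    by (intro semidecidable_comp[OF re_set_semidecidable] recursive1_intros assms)
  then show ?thesis by (simp add: lang_def)
qed

text \<open>Each inclusion is a disjunction of a negated semidecidable and a semidecidable
  predicate, and \<open>Pi2\<close> absorbs the quantifier over \<open>x\<close>.\<close>

lemma Pi2_lang_eq:
  assumes "recursive1 f" "recursive1 g" "recursive1 h"
  shows "Pi2 (\<lambda>z. lang W (f z) (g z) = lang W (f z) (h z))"
proof -
  have "Pi2 (\<lambda>z. \<forall>x. (x \<notin> lang W (f z) (g z) \<or> x \<in> lang W (f z) (h z)) \<and>
      (x \<notin> lang W (f z) (h z) \<or> x \<in> lang W (f z) (g z)))"
    by (intro Pi2_all Pi2_conj Pi2_disj Pi2_semidecidable Pi2_not_semidecidable semidecidable_lang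
        recursive1_intros assms[THEN recursive1_comp])
  then show ?thesis by (rule back_subst[of Pi2]) blast
qed

lemma semidecidable_pos_consistent:
  assumes "recursive1 f" "recursive1 g" "recursive1 p"
  shows "semidecidable (\<lambda>z. set_of_code (p z) \<subseteq> lang W (f z) (g z))"
proof -
  have "semidecidable (\<lambda>z. \<forall>n<p1 (p z). n \<notin> set_of_code (p z) \<or> n \<in> lang W (f z) (g z))"
    by (intro semidecidable_ball semidecidable_disj semidecidable_decidable decidable_not
        decidable_set_of_code semidecidable_lang recursive1_intros assms assms[THEN recursive1_comp])
  then show ?thesis by (rule back_subst[of semidecidable]) (auto simp: set_of_code_def)
qed

text \<open>For negative examples it is inconsistency that is confirmed by a single witness, a
  common element.\<close>

lemma semidecidable_neg_inconsistent:
  assumes "recursive1 f" "recursive1 g" "recursive1 q"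
  shows "semidecidable (\<lambda>z. set_of_code (q z) \<inter> lang W (f z) (g z) \<noteq> {})"
proof -
  have "semidecidable (\<lambda>z. \<exists>n. n \<in> set_of_code (q z) \<and> n \<in> lang W (f z) (g z))"
    by (intro semidecidable_ex semidecidable_conj semidecidable_decidable
        decidable_set_of_code semidecidable_lang recursive1_intros assms[THEN recursive1_comp])
  then show ?thesis by (rule back_subst[of semidecidable]) blast
qed

text \<open>The witness \<open>m\<close> encodes both an index \<open>p1 m\<close> of one of the exceptions and the positive
  and negative part of a teaching set; one of the two has to be valid.\<close>

lemma Sigma0_I_TD_almost_all: "Sigma0 5 (I_TD_almost_all W)"
proof -
  \<comment> \<open>Implication and disjointness are written with disjunctions and a negated
    \<open>\<noteq>\<close>, the shapes that the closure rules match.\<close>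
  define M where "M e N k m \<longleftrightarrow>
     p1 m \<le> N \<and> lang W e k = lang W e (p1 m) \<or>
     set_of_code (p1 (p2 m)) \<subseteq> lang W e k \<and>
     \<not> set_of_code (p2 (p2 m)) \<inter> lang W e k \<noteq> {} \<and>
     (\<forall>l. (\<not> set_of_code (p1 (p2 m)) \<subseteq> lang W e l \<or>
           set_of_code (p2 (p2 m)) \<inter> lang W e l \<noteq> {}) \<or>
         lang W e l = lang W e k)" for e N k m
  have "Pi2 (\<lambda>w. M (p1 w) (p1 (p2 w)) (p1 (p2 (p2 w))) (p2 (p2 (p2 w))))"
    unfolding M_def
    by (intro Pi2_disj Pi2_conj Pi2_all Pi2_lang_eq
        Pi2_semidecidable[OF semidecidable_decidable[OF decidable_le]]
        Pi2_semidecidable[OF semidecidable_pos_consistent]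
        Pi2_not_semidecidable[OF semidecidable_pos_consistent]
        Pi2_semidecidable[OF semidecidable_neg_inconsistent]
        Pi2_not_semidecidable[OF semidecidable_neg_inconsistent]
        recursive1_intros)
  then have "Sigma0 5 {e. \<exists>N. \<forall>k. \<exists>m. M e N k m}" by (rule Sigma0_5I)
  also have "{e. \<exists>N. \<forall>k. \<exists>m. M e N k m} = I_TD_almost_all W"
  proof (intro set_eqI)
    fix e
    let ?bad = "\<lambda>L. \<not> TD L (lang_family W e) < \<infinity>"
    define T where "T k p q \<longleftrightarrow> set_of_code p \<subseteq> lang W e k \<and> \<not> set_of_code q \<inter> lang W e k \<noteq> {} \<and>
     (\<forall>l. (\<not> set_of_code p \<subseteq> lang W e l \<or> set_of_code q \<inter> lang W e l \<noteq> {}) \<or>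
         lang W e l = lang W e k)" for k p q
    have T_iff: "\<not> ?bad (lang W e k) \<longleftrightarrow> (\<exists>p q. T k p q)" for k
      unfolding TD_less_infinity_iff_codes T_def lang_family_def by (simp add: disj_imp imp_conjL)
    have M_iff: "(\<exists>m. M e N k m) \<longleftrightarrow> \<not> ?bad (lang W e k) \<or> (\<exists>i\<le>N. lang W e k = lang W e i)" for N k
    proof
      assume "\<exists>m. M e N k m"
      then obtain m where "M e N k m" ..
      then have "p1 m \<le> N \<and> lang W e k = lang W e (p1 m) \<or> T k (p1 (p2 m)) (p2 (p2 m))"
        unfolding M_def T_def .
      then show "\<not> ?bad (lang W e k) \<or> (\<exists>i\<le>N. lang W e k = lang W e i)"
        unfolding T_iff by blast
    next
      assume "\<not> ?bad (lang W e k) \<or> (\<exists>i\<le>N. lang W e k = lang W e i)"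
      \<comment> \<open>Only one alternative has to hold; the components that serve the other are
        arbitrary.\<close>
      then obtain i p q where ipq: "i \<le> N \<and> lang W e k = lang W e i \<or> T k p q"
        unfolding T_iff by blast
      have "M e N k (prod_encode (i, prod_encode (p, q)))"
        unfolding M_def prod_encode_inverse fst_conv snd_conv using ipq unfolding T_def .
      then show "\<exists>m. M e N k m" ..
    qed
    have "finite {L \<in> lang_family W e. ?bad L} \<longleftrightarrow>
      (\<exists>N. \<forall>k. \<not> ?bad (lang W e k) \<or> (\<exists>i\<le>N. lang W e k = lang W e i))" (is "?l \<longleftrightarrow> ?r")
    proof
      assume ?l
      moreover have "{L \<in> lang_family W e. ?bad L} \<subseteq> range (lang W e)"
        by (auto simp: lang_family_def)
      ultimately obtain C where C: "finite C" "{L \<in> lang_family W e. ?bad L} = lang W e ` C"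
        by (meson finite_subset_image)
      have "lang W e k \<in> lang W e ` C" if "?bad (lang W e k)" for k
        using that C(2) by (auto simp: lang_family_def)
      \<comment> \<open>If \<open>C\<close> is empty there are no exceptions, so the unspecified
        value of \<open>Max C\<close> does no harm.\<close>
      then have "\<forall>k. \<not> ?bad (lang W e k) \<or> (\<exists>i\<le>Max C. lang W e k = lang W e i)"
        using C(1) by (metis Max_ge imageE)
      then show ?r by blast
    next
      assume ?r
      then obtain N where "\<forall>k. \<not> ?bad (lang W e k) \<or> (\<exists>i\<le>N. lang W e k = lang W e i)" ..
      then have "lang W e k \<in> lang W e ` {..N}" if "?bad (lang W e k)" for k
        using that by (metis atMost_iff imageI)
      then have "{L \<in> lang_family W e. ?bad L} \<subseteq> lang W e ` {..N}"
        unfolding lang_family_def by blast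
      then show ?l by (rule finite_subset) simp
    qed
    then show "e \<in> {e. \<exists>N. \<forall>k. \<exists>m. M e N k m} \<longleftrightarrow> e \<in> I_TD_almost_all W"
      by (simp add: M_iff I_TD_almost_all_def)
  qed
  finally show ?thesis .
qed

end

section \<open>Gadgets\<close>

definition full :: "nat \<Rightarrow> nat set" where
  "full s = {prod_encode (s, n) | n. True}"

definition seg :: "nat \<Rightarrow> nat \<Rightarrow> nat set" where
  "seg s m = {prod_encode (s, n) | n. n \<le> m}"

text \<open>The disjunct \<open>n \<le> c\<close> makes incomplete members grow with
  \<open>c\<close>. Letting \<open>c'\<close> run up to \<open>c\<close> makes all members from a
  true witness on equal to the whole column, not just one.\<close>

definition chain :: "(nat \<Rightarrow> nat \<Rightarrow> bool) \<Rightarrow> nat \<Rightarrow> nat \<Rightarrow> nat set" where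
  "chain U s c = {prod_encode (s, n) | n. n \<le> c \<or> (\<exists>c'\<le>c. \<forall>d<n. U c' d)}"

lemma mem_full: "prod_encode (s', n) \<in> full s \<longleftrightarrow> s' = s"
  by (auto simp: full_def)

lemma mem_seg: "prod_encode (s', n) \<in> seg s m \<longleftrightarrow> s' = s \<and> n \<le> m"
  by (auto simp: seg_def)

lemma seg_subset_full: "seg s m \<subseteq> full s"
  by (auto simp: seg_def full_def)

lemma seg_neq_full: "seg s m \<noteq> full s'"
proof
  assume eq: "seg s m = full s'"
  have "prod_encode (s', Suc m) \<in> full s'" by (simp add: mem_full)
  then show False unfolding eq[symmetric] mem_seg by simp
qed

lemma inj_full: "inj full"
proof (rule injI)
  fix s s' assume eq: "full s = full s'"
  have "prod_encode (s, 0) \<in> full s" by (simp add: mem_full)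
  then show "s = s'" unfolding eq mem_full .
qed

lemma seg_eq_iff: "seg s m = seg s m' \<longleftrightarrow> m = m'"
proof
  assume eq: "seg s m = seg s m'"
  have "prod_encode (s, m) \<in> seg s m" "prod_encode (s, m') \<in> seg s m'" by (simp_all add: mem_seg)
  with eq show "m = m'" by (metis mem_seg order_antisym)
qed simp

lemma chain_eq_full:
  assumes "c' \<le> c" "\<forall>d. U c' d" shows "chain U s c = full s"
  using assms by (auto simp: chain_def full_def)

text \<open>Each \<open>c' \<le> c\<close> has a counterexample, which bounds the offsets that it
  contributes. The offsets are closed downwards, so they form an initial segment.\<close>

lemma chain_eq_seg:
  assumes "\<not> (\<exists>c'\<le>c. \<forall>d. U c' d)"
  obtains m where "c \<le> m" "chain U s c = seg s m"
proof -
  define X where "X = {n. n \<le> c \<or> (\<exists>c'\<le>c. \<forall>d<n. U c' d)}"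
  from assms obtain g where g: "\<And>c'. c' \<le> c \<Longrightarrow> \<not> U c' (g c')" by metis
  have "X \<subseteq> {..c} \<union> (\<Union>c'\<le>c. {..g c'})"
    using g by (auto simp: X_def not_le[symmetric])
  then have fin: "finite X" by (rule finite_subset) simp
  have c: "c \<in> X" by (simp add: X_def)
  have down: "n \<in> X" if "m \<in> X" "n \<le> m" for m n
    using that unfolding X_def mem_Collect_eq by (meson le_trans less_le_trans)
  have "Max X \<in> X" using c by (intro Max_in[OF fin]) blast
  then have X_iff: "n \<in> X \<longleftrightarrow> n \<le> Max X" for n
    by (meson down Max_ge[OF fin])
  have "chain U s c = {prod_encode (s, n) | n. n \<in> X}" by (simp add: chain_def X_def)
  then have "chain U s c = seg s (Max X)" unfolding X_iff seg_def .
  moreover have "c \<le> Max X" using fin c by (rule Max_ge)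
  ultimately show thesis using that by blast
qed

text \<open>The whole column \<open>s\<close> is in \<open>F\<close> iff \<open>U s\<close> has a
  true witness. It is then a limit of segments of the \<open>V\<close> chain unless
  \<open>V s\<close> has one too, in which case both chains are eventually constant.
  \<open>VU\<close> excludes that only \<open>V s\<close> has one, which would leave arbitrarily
  long segments in the \<open>U\<close> chain.\<close>

lemma not_finite_TD_chains_iff:
  fixes U V :: "nat \<Rightarrow> nat \<Rightarrow> nat \<Rightarrow> bool"
  defines "F \<equiv> {chain (U s) s c | s c. True} \<union> {chain (V s) s c | s c. True}"
  assumes VU: "\<And>s. \<exists>c. \<forall>d. V s c d \<Longrightarrow> \<exists>c. \<forall>d. U s c d"
  shows "{L \<in> F. \<not> TD L F < \<infinity>} = full ` {s. (\<exists>c. \<forall>d. U s c d) \<and> \<not> (\<exists>c. \<forall>d. V s c d)}"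
proof (intro equalityI subsetI)
  have chain_cases: "(\<exists>m\<ge>c. chain Q s c = seg s m) \<or> (chain Q s c = full s \<and> (\<exists>c. \<forall>d. Q c d))"
    for Q s c
  proof (cases "\<exists>c'\<le>c. \<forall>d. Q c' d")
    case True
    then show ?thesis using chain_eq_full by blast
  next
    case False
    then show ?thesis using chain_eq_seg[of c Q s] by metis
  qed
  have F_cases: "(\<exists>s m. L = seg s m) \<or> (\<exists>s. L = full s \<and> (\<exists>c. \<forall>d. U s c d))" if "L \<in> F" for L
  proof -
    from that obtain s c where "L = chain (U s) s c \<or> L = chain (V s) s c"
      unfolding F_def by blast
    then show ?thesis
      using chain_cases[where Q = "U s"] chain_cases[where Q = "V s"] VU[of s] by metis
  qed
  {
    fix s m
    have "TD (seg s m) F < \<infinity>" unfolding TD_less_infinity_iff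
    proof (intro exI conjI ballI impI)
      let ?P = "{prod_encode (s, m)}" and ?N = "{prod_encode (s, Suc m)}"
      show "finite ?P" "finite ?N" "?P \<subseteq> seg s m" "?N \<inter> seg s m = {}" by (simp_all add: mem_seg)
      fix L' assume L': "L' \<in> F" and "?P \<subseteq> L' \<and> ?N \<inter> L' = {}"
      then have PN: "prod_encode (s, m) \<in> L'" "prod_encode (s, Suc m) \<notin> L'" by auto
      from F_cases[OF L'] show "L' = seg s m"
      proof (elim disjE exE conjE)
        fix s' m' assume "L' = seg s' m'"
        with PN show ?thesis by (auto simp: mem_seg not_less_eq_eq intro: arg_cong2[where f = seg])
      next
        fix s' assume "L' = full s'"
        with PN show ?thesis by (simp add: mem_full)
      qed
    qed
  } note seg = this
  {
    fix s assume V: "\<exists>c. \<forall>d. V s c d"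
    then obtain c0 where c0: "\<forall>d. V s c0 d" by blast
    from VU[OF V] obtain c1 where c1: "\<forall>d. U s c1 d" by blast
    \<comment> \<open>From \<open>c1\<close> and \<open>c0\<close> on the chains equal the whole
      column, so the finite set \<open>?A\<close> contains every segment of column \<open>s\<close>
      that lies in \<open>F\<close>.\<close>
    let ?A = "chain (U s) s ` {..<c1} \<union> chain (V s) s ` {..<c0}"
    have "finite {m. seg s m \<in> ?A}"
    proof (rule finite_vimageI[of ?A "seg s", unfolded vimage_def])
      show "inj (seg s)" by (rule injI) (simp add: seg_eq_iff)
    qed simp
    then obtain M where M: "\<forall>m\<in>{m. seg s m \<in> ?A}. m < M"
      using finite_nat_set_iff_bounded[THEN iffD1] by blast
    have M': "m < M" if "seg s m \<in> F" for m
    proof -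
      from that obtain s' c where sc: "seg s m = chain (U s') s' c \<or> seg s m = chain (V s') s' c"
        unfolding F_def by blast
      \<comment> \<open>Every member of a chain contains offset 0 of its column, which identifies
        the column.\<close>
      have "prod_encode (s', 0) \<in> chain Q s' c" for Q by (auto simp: chain_def)
      with sc have s': "s' = s" by (metis mem_seg)
      have "\<not> c1 \<le> c" if "seg s m = chain (U s) s c"
        using chain_eq_full[of c1 c "U s" s] c1 that seg_neq_full by metis
      moreover have "\<not> c0 \<le> c" if "seg s m = chain (V s) s c"
        using chain_eq_full[of c0 c "V s" s] c0 that seg_neq_full by metis
      ultimately have "seg s m \<in> ?A" using sc unfolding s' by auto
      with M show ?thesis by blast
    qed
    have "TD (full s) F < \<infinity>" unfolding TD_less_infinity_iff
    proof (intro exI conjI ballI impI)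
      \<comment> \<open>One positive example beyond all segments of column \<open>s\<close> in
        \<open>F\<close> suffices; it also excludes the other columns.\<close>
      let ?P = "{prod_encode (s, M)}"
      show "finite ?P" "finite ({} :: nat set)" "?P \<subseteq> full s" "{} \<inter> full s = {}"
        by (simp_all add: mem_full)
      fix L' assume L': "L' \<in> F" and "?P \<subseteq> L' \<and> {} \<inter> L' = {}"
      then have P: "prod_encode (s, M) \<in> L'" by auto
      from F_cases[OF L'] show "L' = full s"
      proof (elim disjE exE conjE)
        fix s' m' assume "L' = seg s' m'"
        with P L' M' have False by (metis mem_seg not_le)
        then show ?thesis ..
      next
        fix s' assume "L' = full s'"
        with P show ?thesis by (simp add: mem_full)
      qed
    qed
  } note full = this
  fix L assume "L \<in> {L \<in> F. \<not> TD L F < \<infinity>}"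
  then have L: "L \<in> F" "\<not> TD L F < \<infinity>" by blast+
  from F_cases[OF L(1)] L(2) seg obtain s where s: "L = full s" "\<exists>c. \<forall>d. U s c d" by metis
  moreover have "\<not> (\<exists>c. \<forall>d. V s c d)" using full[of s] L(2) s(1) by blast
  ultimately show "L \<in> full ` {s. (\<exists>c. \<forall>d. U s c d) \<and> \<not> (\<exists>c. \<forall>d. V s c d)}" by blast
next
  fix L assume "L \<in> full ` {s. (\<exists>c. \<forall>d. U s c d) \<and> \<not> (\<exists>c. \<forall>d. V s c d)}"
  then obtain s where s: "L = full s" "\<exists>c. \<forall>d. U s c d" "\<not> (\<exists>c. \<forall>d. V s c d)" by blast
  from s(2) obtain c where "\<forall>d. U s c d" by blast
  then have "L = chain (U s) s c" using chain_eq_full[of c c "U s" s] s(1) by simp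
  then have "L \<in> F" unfolding F_def by blast
  moreover have "\<not> TD L F < \<infinity>"
  proof
    assume "TD L F < \<infinity>"
    then obtain P N where PN: "finite P" "P \<subseteq> L" "N \<inter> L = {}"
      "\<forall>L'\<in>F. P \<subseteq> L' \<and> N \<inter> L' = {} \<longrightarrow> L' = L"
      unfolding TD_less_infinity_iff by metis
    \<comment> \<open>\<open>P\<close> is finite, so a long enough segment of the \<open>V\<close>
      chain contains it; as a subset of the column the segment also avoids \<open>N\<close>.\<close>
    from PN(1) obtain c where c: "\<forall>n\<in>p2 ` P. n < c"
      using finite_nat_set_iff_bounded[THEN iffD1] by blast
    obtain m where m: "c \<le> m" "chain (V s) s c = seg s m"
      using chain_eq_seg[of c "V s" s] s(3) by metis
    have "seg s m \<in> F" unfolding F_def m(2)[symmetric] by blast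
    moreover have "P \<subseteq> seg s m"
    proof
      fix x assume x: "x \<in> P"
      with PN(2) s(1) obtain n where n: "x = prod_encode (s, n)" unfolding full_def by blast
      have "p2 x < c" using c x by blast
      then show "x \<in> seg s m" using m(1) by (simp add: n mem_seg)
    qed
    moreover have "N \<inter> seg s m = {}" using PN(3) s(1) seg_subset_full by blast
    ultimately have "seg s m = full s" using PN(4) s(1) by metis
    then show False by (simp add: seg_neq_full)
  qed
  ultimately show "L \<in> {L \<in> F. \<not> TD L F < \<infinity>}" by blast
qed

section \<open>Hardness\<close>

text \<open>Row \<open>Q a\<close> has exactly one switch point if it fails somewhere and none
  otherwise, and by \<open>mono\<close> the rows without one are closed upwards. Hence there are
  finitely many iff some row has none.\<close>

lemma finite_switch_points_iff:
  fixes Q :: "nat \<Rightarrow> nat \<Rightarrow> bool"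
  assumes zero: "\<And>a. Q a 0"
    and anti: "\<And>a b b'. Q a b' \<Longrightarrow> b \<le> b' \<Longrightarrow> Q a b"
    and mono: "\<And>a a' b. Q a b \<Longrightarrow> a \<le> a' \<Longrightarrow> Q a' b"
  shows "finite {s. Q (p1 s) (p2 s) \<and> \<not> Q (p1 s) (Suc (p2 s))} \<longleftrightarrow> (\<exists>a. \<forall>b. Q a b)"
    (is "finite ?S \<longleftrightarrow> _")
proof
  assume fin: "finite ?S"
  show "\<exists>a. \<forall>b. Q a b"
  proof (rule ccontr)
    assume no: "\<not> (\<exists>a. \<forall>b. Q a b)"
    have "a \<in> p1 ` ?S" for a
    proof -
      from no obtain b where "\<not> Q a b" by blast
      then have "\<exists>b. Q a b \<and> \<not> Q a (Suc b)"
        using zero[of a] by (induction b) blast+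
      then obtain b where b: "Q a b" "\<not> Q a (Suc b)" by blast
      then show ?thesis by (intro image_eqI[of _ _ "prod_encode (a, b)"]) simp_all
    qed
    then have "p1 ` ?S = UNIV" by blast
    moreover have "finite (p1 ` ?S)" using fin by (rule finite_imageI)
    ultimately show False by simp
  qed
next
  assume "\<exists>a. \<forall>b. Q a b"
  then obtain a where a: "\<And>b. Q a b" by blast
  show "finite ?S"
  proof (rule inj_on_finite)
    show "p1 ` ?S \<subseteq> {..<a}"
      using mono[OF a] by (auto simp: not_le[symmetric])
    show "inj_on p1 ?S"
    proof (rule inj_onI)
      fix s t assume s: "s \<in> ?S" and t: "t \<in> ?S" and eq: "p1 s = p1 t"
      \<comment> \<open>If one switch point of a row preceded another, \<open>anti\<close> would
        make \<open>Q\<close> hold right after it.\<close>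
      have "p2 s = p2 t"
        using s t anti[of "p1 t" "p2 s" "Suc (p2 t)"] anti[of "p1 t" "p2 t" "Suc (p2 s)"]
        unfolding eq by (metis (mono_tags, lifting) Suc_leI linorder_neqE_nat mem_Collect_eq eq)
      with eq show "s = t" by (metis prod.collapse prod_decode_inverse)
    qed
  qed simp
qed

text \<open>Makes \<open>\<exists>c. \<forall>d. S a b c d\<close> monotone in \<open>a\<close> and antitone in \<open>b\<close> without changing the truth of
  \<open>\<exists>a. \<forall>b\<close> in front of it. The new \<open>b\<close> ranges over codes \<open>\<beta>\<close> of sequences, one value of the old
  \<open>b\<close> for each \<open>a' \<le> a\<close>, and \<open>\<gamma>\<close> lists the pairs of witnesses \<open>(a', c)\<close> for the \<open>\<beta> < B\<close>.\<close>

definition bounded_choice :: "(nat \<Rightarrow> nat \<Rightarrow> nat \<Rightarrow> nat \<Rightarrow> bool) \<Rightarrow> nat \<Rightarrow> nat \<Rightarrow> nat \<Rightarrow> nat \<Rightarrow> bool" where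
  "bounded_choice S a B \<gamma> d \<longleftrightarrow> (\<forall>\<beta><B. p1 (seq_nth \<gamma> \<beta>) \<le> a \<and>
     S (p1 (seq_nth \<gamma> \<beta>)) (seq_nth \<beta> (p1 (seq_nth \<gamma> \<beta>))) (p2 (seq_nth \<gamma> \<beta>)) d)"

text \<open>\<open>\<gamma>\<close> collects finitely many witness pairs, one for each
  \<open>\<beta> < B\<close>. The pairs must not depend on \<open>d\<close>, hence the order of the
  quantifiers.\<close>

lemma ex_bounded_choice_iff:
  "(\<exists>\<gamma>. \<forall>d. bounded_choice S a B \<gamma> d) \<longleftrightarrow>
   (\<forall>\<beta><B. \<exists>a'\<le>a. \<exists>c. \<forall>d. S a' (seq_nth \<beta> a') c d)" (is "?l \<longleftrightarrow> ?r")
proof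
  assume ?l
  then show ?r unfolding bounded_choice_def by metis
next
  assume ?r
  then obtain f g where fg: "\<And>\<beta>. \<beta> < B \<Longrightarrow> f \<beta> \<le> a \<and> (\<forall>d. S (f \<beta>) (seq_nth \<beta> (f \<beta>)) (g \<beta>) d)"
    by metis
  obtain \<gamma> where "\<forall>\<beta><B. seq_nth \<gamma> \<beta> = prod_encode (f \<beta>, g \<beta>)"
    using ex_seq_nth[of B "\<lambda>\<beta>. prod_encode (f \<beta>, g \<beta>)"] by blast
  with fg have "\<forall>d. bounded_choice S a B \<gamma> d" unfolding bounded_choice_def by simp
  then show ?l by blast
qed

text \<open>If each \<open>a\<close> failed at some \<open>h a\<close>, a code of the values
  \<open>h 0\<close> to \<open>h a\<close> would refute every \<open>a' \<le> a\<close> at once.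
  Conversely, \<open>a' = a\<close> works for every \<open>\<beta>\<close>.\<close>

lemma all_ex_bounded_choice_iff:
  "(\<exists>a. \<forall>B. \<exists>\<gamma>. \<forall>d. bounded_choice S a B \<gamma> d) \<longleftrightarrow> (\<exists>a. \<forall>b. \<exists>c. \<forall>d. S a b c d)"
proof
  assume "\<exists>a. \<forall>B. \<exists>\<gamma>. \<forall>d. bounded_choice S a B \<gamma> d"
  \<comment> \<open>Every \<open>\<beta>\<close> is below some \<open>B\<close>, so the bound on
    \<open>\<beta>\<close> drops out.\<close>
  then obtain a where a: "\<And>\<beta>. \<exists>a'\<le>a. \<exists>c. \<forall>d. S a' (seq_nth \<beta> a') c d"
    unfolding ex_bounded_choice_iff by blast
  show "\<exists>a. \<forall>b. \<exists>c. \<forall>d. S a b c d"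
  proof (rule ccontr)
    assume "\<not> (\<exists>a. \<forall>b. \<exists>c. \<forall>d. S a b c d)"
    then obtain h where h: "\<And>a. \<not> (\<exists>c. \<forall>d. S a (h a) c d)" by metis
    obtain \<beta> where "\<forall>i<Suc a. seq_nth \<beta> i = h i" using ex_seq_nth[of "Suc a" h] by blast
    with a[of \<beta>] h show False by (metis less_Suc_eq_le)
  qed
next
  assume "\<exists>a. \<forall>b. \<exists>c. \<forall>d. S a b c d"
  then obtain a where "\<And>b. \<exists>c. \<forall>d. S a b c d" by blast
  then have "\<forall>B. \<forall>\<beta><B. \<exists>a'\<le>a. \<exists>c. \<forall>d. S a' (seq_nth \<beta> a') c d" by blast
  then show "\<exists>a. \<forall>B. \<exists>\<gamma>. \<forall>d. bounded_choice S a B \<gamma> d" unfolding ex_bounded_choice_iff by blast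
qed

section \<open>The reduction\<close>

lemma many_one_reducible_I_TD_almost_all:
  assumes W: "acceptable_numbering W" and A: "Sigma0 5 A"
  shows "many_one_reducible A (I_TD_almost_all W)"
proof -
  from A obtain R where R: "\<And>f0 f1 f2 f3 f4 f5. recursive1 f0 \<Longrightarrow> recursive1 f1 \<Longrightarrow> recursive1 f2 \<Longrightarrow>
      recursive1 f3 \<Longrightarrow> recursive1 f4 \<Longrightarrow> recursive1 f5 \<Longrightarrow>
      decidable (\<lambda>z. R (f0 z) (f1 z) (f2 z) (f3 z) (f4 z) (f5 z))"
    and A_iff: "\<And>x. x \<in> A \<longleftrightarrow> (\<exists>a. \<forall>b. \<exists>c. \<forall>d. \<exists>e. R x a b c d e)" by (rule Sigma0_5E) blast
  define S where "S x a b c d \<longleftrightarrow> (\<exists>e. R x a b c d e)" for x a b c d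
  define U where "U x s = bounded_choice (S x) (p1 s) (p2 s)" for x s
  define V where "V x s = bounded_choice (S x) (p1 s) (Suc (p2 s))" for x s
  \<comment> \<open>An index \<open>j\<close> codes a column, a tag that selects the chain (0 for
    \<open>U\<close>, anything else for \<open>V\<close>) and a position in that chain.\<close>
  define L where "L x j = (if p1 (p2 j) = 0 then chain (U x (p1 j)) (p1 j) (p2 (p2 j))
      else chain (V x (p1 j)) (p1 j) (p2 (p2 j)))" for x j
  \<comment> \<open>Membership in \<open>L x j\<close>, unfolded for the closure rules. The two
    chains differ only in the bound on \<open>\<beta>\<close>, so one conditional serves
    both.\<close>
  define G where "G x j v \<longleftrightarrow> p1 v = p1 j \<and> (p2 v \<le> p2 (p2 j) \<or>
     (\<exists>c. c \<le> p2 (p2 j) \<and> (\<forall>d<p2 v. \<forall>\<beta><(if p1 (p2 j) = 0 then p2 (p1 j) else Suc (p2 (p1 j))).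
        p1 (seq_nth c \<beta>) \<le> p1 (p1 j) \<and>
        (\<exists>e. R x (p1 (seq_nth c \<beta>)) (seq_nth \<beta> (p1 (seq_nth c \<beta>))) (p2 (seq_nth c \<beta>)) d e))))"
    for x j v
  have mem_chain: "v \<in> chain Q s c \<longleftrightarrow> p1 v = s \<and> (p2 v \<le> c \<or> (\<exists>c'\<le>c. \<forall>d<p2 v. Q c' d))" for v Q s c
  proof -
    obtain s' n where "v = prod_encode (s', n)" by (metis prod.collapse prod_decode_inverse)
    then show ?thesis by (auto simp: chain_def)
  qed
  have L_iff: "v \<in> L x j \<longleftrightarrow> G x j v" for x j v
    unfolding L_def G_def U_def V_def by (simp add: mem_chain bounded_choice_def S_def)
  have "semidecidable (\<lambda>z. G (p1 z) (p1 (p2 z)) (p2 (p2 z)))"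
    unfolding G_def
    by (intro semidecidable_conj semidecidable_disj semidecidable_ex semidecidable_ball
        semidecidable_decidable[OF decidable_le] semidecidable_decidable[OF decidable_eq]
        semidecidable_decidable[OF R] decidable_eq recursive1_if recursive1_seq_nth
        recursive1_intros)
  then have "re_set {z. G (p1 z) (p1 (p2 z)) (p2 (p2 z))}" by (rule semidecidable_re_set)
  also have "{z. G (p1 z) (p1 (p2 z)) (p2 (p2 z))} =
      {prod_encode (x, y) |x y. y \<in> {prod_encode (j, v) |j v. v \<in> L x j}}"
  proof (intro set_eqI)
    fix z
    obtain x j v where z: "z = prod_encode (x, prod_encode (j, v))"
      by (metis prod.collapse prod_decode_inverse)
    show "z \<in> {z. G (p1 z) (p1 (p2 z)) (p2 (p2 z))} \<longleftrightarrow>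
        z \<in> {prod_encode (x, y) |x y. y \<in> {prod_encode (j, v) |j v. v \<in> L x j}}"
      unfolding z by (simp add: L_iff)
  qed
  finally have "uniformly_re (\<lambda>x. {prod_encode (j, v) |j v. v \<in> L x j})"
    unfolding uniformly_re_def .
  \<comment> \<open>Acceptability turns the uniform enumeration into a recursive map to indices of
    \<open>W\<close>.\<close>
  then obtain f where f: "recursive1 f" "\<And>x. {prod_encode (j, v) |j v. v \<in> L x j} = W (f x)"
    using W unfolding acceptable_numbering_def by blast
  have lang: "lang W (f x) = L x" for x
    unfolding lang_def f(2)[symmetric] by auto
  have fam: "lang_family W (f x) =
      {chain (U x s) s c |s c. True} \<union> {chain (V x s) s c |s c. True}" for x
  proof -
    have "chain (U x s) s c = L x (prod_encode (s, prod_encode (0, c)))"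
      "chain (V x s) s c = L x (prod_encode (s, prod_encode (1, c)))" for s c
      by (simp_all add: L_def)
    moreover have "L x j \<in> {chain (U x s) s c |s c. True} \<union> {chain (V x s) s c |s c. True}" for j
      unfolding L_def by auto
    ultimately show ?thesis unfolding lang_family_def lang by blast
  qed
  define Q where "Q x a B \<longleftrightarrow> (\<exists>\<gamma>. \<forall>d. bounded_choice (S x) a B \<gamma> d)" for x a B
  have "x \<in> A \<longleftrightarrow> f x \<in> I_TD_almost_all W" for x
  proof -
    have Q_iff: "Q x a B \<longleftrightarrow> (\<forall>\<beta><B. \<exists>a'\<le>a. \<exists>c. \<forall>d. S x a' (seq_nth \<beta> a') c d)" for a B
      unfolding Q_def ex_bounded_choice_iff ..
    have U_iff: "(\<exists>c. \<forall>d. U x s c d) \<longleftrightarrow> Q x (p1 s) (p2 s)"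
      and V_iff: "(\<exists>c. \<forall>d. V x s c d) \<longleftrightarrow> Q x (p1 s) (Suc (p2 s))" for s
      unfolding U_def V_def Q_def by (rule refl)+
    have "f x \<in> I_TD_almost_all W \<longleftrightarrow>
        finite {L \<in> lang_family W (f x). \<not> TD L (lang_family W (f x)) < \<infinity>}"
      unfolding I_TD_almost_all_def by blast
    also have "{L \<in> lang_family W (f x). \<not> TD L (lang_family W (f x)) < \<infinity>} =
        full ` {s. (\<exists>c. \<forall>d. U x s c d) \<and> \<not> (\<exists>c. \<forall>d. V x s c d)}"
      unfolding fam
    proof (rule not_finite_TD_chains_iff)
      \<comment> \<open>\<open>V\<close> differs from \<open>U\<close> only in having to handle one
        more \<open>\<beta>\<close>.\<close>
      fix s assume "\<exists>c. \<forall>d. V x s c d"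
      then show "\<exists>c. \<forall>d. U x s c d" unfolding U_iff V_iff Q_iff by simp
    qed
    \<comment> \<open>\<open>full\<close> is injective, so counting exceptional sets amounts to
      counting exceptional columns.\<close>
    also have "finite \<dots> \<longleftrightarrow> finite {s. Q x (p1 s) (p2 s) \<and> \<not> Q x (p1 s) (Suc (p2 s))}"
      unfolding U_iff V_iff by (rule finite_image_iff) (rule inj_on_subset[OF inj_full subset_UNIV])
    also have "\<dots> \<longleftrightarrow> (\<exists>a. \<forall>B. Q x a B)"
    proof (rule finite_switch_points_iff)
      show "Q x a b" if "Q x a b'" "b \<le> b'" for a b b'
        using that unfolding Q_iff by (meson less_le_trans)
      show "Q x a' b" if "Q x a b" "a \<le> a'" for a a' b
        using that unfolding Q_iff by (meson le_trans)
    qed (simp add: Q_iff)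
    also have "\<dots> \<longleftrightarrow> x \<in> A"
      unfolding Q_def all_ex_bounded_choice_iff A_iff S_def ..
    finally show ?thesis ..
  qed
  with f(1) show ?thesis unfolding many_one_reducible_def by blast
qed

theorem theorem5:
  fixes W :: "nat \<Rightarrow> nat set"
  assumes "acceptable_numbering W"
  shows "Sigma0_complete 5 (I_TD_almost_all W)"
  unfolding Sigma0_complete_def
  using assms Sigma0_I_TD_almost_all many_one_reducible_I_TD_almost_all
  unfolding acceptable_numbering_def by blast

end
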